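(* Let $k\ge2$. The code $C=\Phi_R(\mathcal{S}_k^{\beta})$ over $\mathbb{F}_q$ has length $q^{(s-1)k}\frac{q^k-1}{q-1}$, has $q^{sk}$ codewords, and has minimum Hamming distance $q^{sk-k-1}(q^k-1)$. Moreover its Hamming weight enumerator is $W_C(X,Y)=\sum_{\ell}A_\ell X^{n'-\ell}Y^\ell$, where $n'=q^{(s-1)k}\frac{q^k-1}{q-1}$ and $A_\ell=1$ if $\ell=0$; $A_\ell=q^k-1$ if $\ell=q^{sk-1}$; $A_\ell=q^{sk}-q^k$ if $\ell=q^{sk-k-1}(q^k-1)$; and $A_\ell=0$ otherwise.
   Context: Let $R$ be a finite commutative chain ring: a finite commutative ring with $1\neq0$ whose ideals form a single chain under inclusion. Its unique maximal ideal is principal, generated by some $\gamma$; let $s\ge1$ be the least integer with $\gamma^s=0$. The residue field $R/\langle\gamma\rangle$ is isomorphic to $\mathbb{F}_q$, $q$ a prime power, and $\bar r$ denotes the image of $r$. Fix coset representatives $T=\{e_0,\dots,e_{q-1}\}$ of $R/\langle\gamma\rangle$ with $e_0=0,e_1=1$, ordered $e_0<\dots<e_{q-1}$. Every $r\in R$ has a unique $\gamma$-adic representation $r=\sum_{i=0}^{s-1}r_i\gamma^i$, $r_i\in T$. Order $R$ by: $x>y$ iff $x_i>y_i$ in $T$ for the largest $i$ with $x_i\neq y_i$. List $R=\{\rho_0,\dots,\rho_{q^s-1}\}$ increasingly. For $a\in R$, $\mathbf{a}^{(m)}$ is the constant vector of length $m$. Define $G_1^\alpha=(\rho_0\ \cdots\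 \rho_{q^s-1})$ and, for $k>1$, $G_k^\alpha$ as the matrix of $q^s$ column blocks, the $j$-th having first row $\boldsymbol{\rho_j}^{(q^{s(k-1)})}$ and a copy of $G_{k-1}^\alpha$ below. Write the elements of the ideal $\langle\gamma\rangle$ in increasing order as $a_0\gamma<a_1\gamma<\dots<a_{q^{s-1}-1}\gamma$ (so $a_0\gamma=0$). Define $G_1^\beta=(1)$ and, for $k>1$, $G_k^\beta$ as the matrix with column blocks: first a block with first row $\mathbf{1}^{(q^{s(k-1)})}$ and $G_{k-1}^\alpha$ below; then, for each $j=0,\dots,q^{s-1}-1$, a block with first row the constant vector with entry $a_j\gamma$ and $G_{k-1}^\beta$ below. $\mathcal{S}_k^\beta$ is the $R$-submodule generated by the rows of $G_k^\beta$. Gray map: let $M$ be the $s\times q^{s-1}$ matrix over $\mathbb{F}_q$ (a generator matrix of the first order $q$-ary Reed–Muller code of length $q^{s-1}$) whose columns are exactly the vectors $(v,1)^T$, $v\in\mathbb{F}_q^{s-1}$; $\Phi_R(r)=(\bar r_0,\dots,\bar r_{s-1})M$, extended coordinatewise to $R^n$. The Hamming weight enumerator of a code $C$ of length $n$ is $\sum_iA_iX^{n-i}Y^i$ with $A_i$ the number of codewords of Hamming weight $i$.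
   Formalization: The formal theorem assumes s ≥ 2; for s = 1 (R = F_q) the stated minimum distance q^{sk-k-1}(q^k-1) = (q^k-1)/q is not an integer (e.g. q = 2, k = 2 gives 3/2, while the true value is 2), so the statement fails there. *)

theory Defs
  imports Main
begin

definition is_ideal :: "'a::comm_ring_1 set \<Rightarrow> bool" where
  "is_ideal I \<longleftrightarrow> 0 \<in> I \<and> (\<forall>x\<in>I. \<forall>y\<in>I. x + y \<in> I) \<and> (\<forall>r. \<forall>x\<in>I. r * x \<in> I)"

definition is_chain_ring :: "'a::{comm_ring_1,finite} itself \<Rightarrow> bool" where
  "is_chain_ring _ \<longleftrightarrow>
     (\<forall>I J :: 'a set. is_ideal I \<longrightarrow> is_ideal J \<longrightarrow> I \<subseteq> J \<or> J \<subseteq> I)"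

definition is_ring_hom :: "('a::comm_ring_1 \<Rightarrow> 'b::comm_ring_1) \<Rightarrow> bool" where
  "is_ring_hom f \<longleftrightarrow> (\<forall>x y. f (x + y) = f x + f y) \<and> (\<forall>x y. f (x * y) = f x * f y) \<and> f 1 = 1"

definition pideal :: "'a::comm_ring_1 \<Rightarrow> 'a set" where
  "pideal g = {g * r | r. True}"

text \<open>Coset representatives are e 0, ..., e (q-1) (ordered by index).
  The gamma-adic digit of r at position i is e (digit g s e q r i).\<close>
definition digit :: "'a::comm_ring_1 \<Rightarrow> nat \<Rightarrow> (nat \<Rightarrow> 'a) \<Rightarrow> nat \<Rightarrow> 'a \<Rightarrow> nat \<Rightarrow> nat" where
  "digit g s e q r = (THE d. (\<forall>i<s. d i < q) \<and> (\<forall>i\<ge>s. d i = 0) \<and>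
                             r = (\<Sum>i<s. e (d i) * g ^ i))"

definition gtR :: "'a::comm_ring_1 \<Rightarrow> nat \<Rightarrow> (nat \<Rightarrow> 'a) \<Rightarrow> nat \<Rightarrow> 'a \<Rightarrow> 'a \<Rightarrow> bool" where
  "gtR g s e q x y \<longleftrightarrow> (\<exists>i<s. digit g s e q x i > digit g s e q y i \<and>
        (\<forall>j. i < j \<and> j < s \<longrightarrow> digit g s e q x j = digit g s e q y j))"

definition rho :: "'a::{comm_ring_1,finite} \<Rightarrow> nat \<Rightarrow> (nat \<Rightarrow> 'a) \<Rightarrow> nat \<Rightarrow> nat \<Rightarrow> 'a" where
  "rho g s e q j = (THE x. card {y. gtR g s e q x y} = j)"

text \<open>aelt j: the j-th element (0-based) of the ideal generated by gamma in increasing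
  order, i.e. the element a_j gamma of the paper.\<close>
definition aelt :: "'a::{comm_ring_1,finite} \<Rightarrow> nat \<Rightarrow> (nat \<Rightarrow> 'a) \<Rightarrow> nat \<Rightarrow> nat \<Rightarrow> 'a" where
  "aelt g s e q j = (THE x. x \<in> pideal g \<and> card {y \<in> pideal g. gtR g s e q x y} = j)"

definition block :: "'a \<Rightarrow> 'a list list \<Rightarrow> 'a list list" where
  "block c M = replicate (length (hd M)) c # M"

definition hconcat :: "nat \<Rightarrow> 'a list list list \<Rightarrow> 'a list list" where
  "hconcat m Bs = map (\<lambda>i. concat (map (\<lambda>B. B ! i) Bs)) [0..<m]"

fun Galpha :: "'a::{comm_ring_1,finite} \<Rightarrow> nat \<Rightarrow> (nat \<Rightarrow> 'a) \<Rightarrow> nat \<Rightarrow> nat \<Rightarrow> 'a list list" where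
  "Galpha g s e q 0 = []"
| "Galpha g s e q (Suc 0) = [map (rho g s e q) [0..<q ^ s]]"
| "Galpha g s e q (Suc (Suc k)) =
     hconcat (Suc (Suc k)) (map (\<lambda>j. block (rho g s e q j) (Galpha g s e q (Suc k))) [0..<q ^ s])"

fun Gbeta :: "'a::{comm_ring_1,finite} \<Rightarrow> nat \<Rightarrow> (nat \<Rightarrow> 'a) \<Rightarrow> nat \<Rightarrow> nat \<Rightarrow> 'a list list" where
  "Gbeta g s e q 0 = []"
| "Gbeta g s e q (Suc 0) = [[1]]"
| "Gbeta g s e q (Suc (Suc k)) =
     hconcat (Suc (Suc k))
       (block 1 (Galpha g s e q (Suc k)) #
        map (\<lambda>j. block (aelt g s e q j) (Gbeta g s e q (Suc k))) [0..<q ^ (s - 1)])"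

definition row_module :: "'a::comm_ring_1 list list \<Rightarrow> 'a list set" where
  "row_module G = {map (\<lambda>j. \<Sum>i<length G. c i * (G ! i ! j)) [0..<length (hd G)] | c. True}"

text \<open>vs lists the columns v of M (each column is (v,1)); the Gray image of r is
  (r_0-bar, ..., r_(s-1)-bar) M.\<close>
definition gray :: "('a::comm_ring_1 \<Rightarrow> 'f::field) \<Rightarrow> 'a \<Rightarrow> nat \<Rightarrow> (nat \<Rightarrow> 'a) \<Rightarrow> nat
                    \<Rightarrow> 'f list list \<Rightarrow> 'a \<Rightarrow> 'f list" where
  "gray p g s e q vs r =
     map (\<lambda>v. (\<Sum>i<s - 1. p (e (digit g s e q r i)) * v ! i) + p (e (digit g s e q r (s - 1)))) vs"

definition gray_vec :: "('a::comm_ring_1 \<Rightarrow> 'f::field) \<Rightarrow> 'a \<Rightarrow> nat \<Rightarrow> (nat \<Rightarrow> 'a) \<Rightarrow> nat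
                    \<Rightarrow> 'f list list \<Rightarrow> 'a list \<Rightarrow> 'f list" where
  "gray_vec p g s e q vs x = concat (map (gray p g s e q vs) x)"

definition hweight :: "'f::zero list \<Rightarrow> nat" where
  "hweight x = card {i. i < length x \<and> x ! i \<noteq> 0}"

definition hdist :: "'f list \<Rightarrow> 'f list \<Rightarrow> nat" where
  "hdist x y = card {i. i < length x \<and> x ! i \<noteq> y ! i}"

definition min_dist :: "'f list set \<Rightarrow> nat" where
  "min_dist C = Min {hdist x y | x y. x \<in> C \<and> y \<in> C \<and> x \<noteq> y}"

definition wt_count :: "'f::zero list set \<Rightarrow> nat \<Rightarrow> nat" where
  "wt_count C l = card {x \<in> C. hweight x = l}"

end

theory Submission
  imports Defs
begin

text \<open>
  The Gray map is an isometry from the metric induced by the homogeneous weight \<open>w\<close> to the Hamming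
  metric: two elements differing by a nonzero socle element have Gray images differing by a nonzero
  constant, any other two distinct elements have images differing by a nonconstant affine form. As
  \<open>w\<close> has the same average \<open>W = (q - 1) q^(s - 2)\<close> on every coset of every nonzero ideal, the sum of
  \<open>w (c \<bullet> u)\<close> over all \<open>u \<in> R^k\<close> is \<open>q^(s k) W\<close> for \<open>c \<noteq> 0\<close>, and the sum over all
  \<open>u \<in> (\<gamma> R)^k\<close> is \<open>q^((s - 1) k) W\<close> or \<open>0\<close> according to whether \<open>\<gamma> c \<noteq> 0\<close>. The
  difference is the sum over the vectors with a unit entry, and each of these is a unique unit
  multiple of a column of the beta matrix. Dividing by the number \<open>q W\<close> of units gives the weight of
  the codeword with coefficient vector \<open>c\<close>.
\<close>

section \<open>Sums over vectors and columns of matrices\<close>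

definition vecs :: "'a set \<Rightarrow> nat \<Rightarrow> 'a list set" where
  "vecs J k = {u. set u \<subseteq> J \<and> length u = k}"

lemma vecs_0: "vecs J 0 = {[]}"
  by (auto simp: vecs_def)

lemma card_vecs: "finite J \<Longrightarrow> card (vecs J k) = card J ^ k"
  unfolding vecs_def by (rule card_lists_length_eq)

lemma finite_vecs: "finite J \<Longrightarrow> finite (vecs J k)"
  unfolding vecs_def by (rule finite_lists_length_eq)

lemma sum_vecs_Suc:
  "sum f (vecs J (Suc k)) = (\<Sum>a\<in>J. \<Sum>u\<in>vecs J k. f (a # u))"
proof -
  have "vecs J (Suc k) = (\<lambda>(a, u). a # u) ` (J \<times> vecs J k)"
    by (auto simp: vecs_def length_Suc_conv image_iff)
  moreover have "inj_on (\<lambda>(a, u). a # u) (J \<times> vecs J k)"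
    by (auto simp: inj_on_def)
  ultimately show ?thesis
    by (simp add: sum.reindex sum.cartesian_product case_prod_unfold)
qed

definition dot :: "(nat \<Rightarrow> 'a::comm_ring_1) \<Rightarrow> 'a list \<Rightarrow> 'a" where
  "dot c u = (\<Sum>i<length u. c i * u ! i)"

lemma dot_Cons: "dot c (a # u) = c 0 * a + dot (\<lambda>i. c (Suc i)) u"
  by (simp add: dot_def sum.lessThan_Suc_shift del: sum.lessThan_Suc)

lemma dot_diff: "dot (\<lambda>i. c i - d i) u = dot c u - dot d u"
  by (simp add: dot_def left_diff_distrib sum_subtractf)

lemma dot_scale: "dot c (map ((*) t) u) = t * dot c u"
  by (simp add: dot_def sum_distrib_left mult.left_commute)

definition cols :: "'a list list \<Rightarrow> 'a list list" where
  "cols G = map (\<lambda>j. map (\<lambda>i. G ! i ! j) [0..<length G]) [0..<length (hd G)]"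

definition rect :: "nat \<Rightarrow> 'a list list \<Rightarrow> bool" where
  "rect m G \<longleftrightarrow> length G = m \<and> (\<forall>r\<in>set G. length r = length (hd G))"

lemma cols_length: "u \<in> set (cols G) \<Longrightarrow> length u = length G"
  by (auto simp: cols_def)

text \<open>The entries of a codeword are the scalar products of one coefficient vector with the
  columns. From here on a matrix matters only through its list of columns, which suits a recursion
  by column blocks.\<close>

lemma row_module_cols: "row_module G = range (\<lambda>c. map (dot c) (cols G))"
  by (auto simp: row_module_def cols_def dot_def image_def)

lemma rect_block: "rect m M \<Longrightarrow> rect (Suc m) (block c M)"
  by (auto simp: rect_def block_def)

lemma cols_block: "cols (block c M) = map ((#) c) (cols M)"
  by (simp add: cols_def block_def map_upt_Suc del: upt_Suc)

lemma hconcat_Cons: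
  "hconcat m (B # Bs) = map (\<lambda>i. B ! i @ hconcat m Bs ! i) [0..<m]"
  by (simp add: hconcat_def)

lemma rect_nth: "rect m G \<Longrightarrow> i < m \<Longrightarrow> length (G ! i) = length (hd G)"
  by (auto simp: rect_def)

lemma rect_hconcat:
  assumes "\<forall>B\<in>set Bs. rect m B"
  shows "rect m (hconcat m Bs)"
proof (cases "m = 0")
  case False
  have *: "length (concat (map (\<lambda>B. B ! i) Bs)) = (\<Sum>B\<leftarrow>Bs. length (hd B))" if "i < m" for i
    using assms that by (induction Bs) (auto simp: rect_nth)
  with False show ?thesis
    by (auto simp: rect_def hconcat_def hd_map)
qed (simp add: rect_def hconcat_def)

lemma cols_hconcat:
  assumes "\<forall>B\<in>set Bs. rect m B" and m: "m > 0"
  shows "cols (hconcat m Bs) = concat (map cols Bs)"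
  using assms(1)
proof (induction Bs)
  case Nil
  then show ?case using m by (simp add: cols_def hconcat_def hd_map)
next
  case (Cons B Bs)
  let ?H = "hconcat m Bs" and ?n = "length (hd B)"
  let ?n' = "length (hd ?H)"
  have B: "rect m B" and H: "rect m ?H"
    using Cons.prems by (auto intro: rect_hconcat)
  have lB: "length B = m" "length ?H = m" using B H by (auto simp: rect_def)
  have hd0: "hd B = B ! 0" "hd ?H = ?H ! 0"
    using m lB by (metis hd_conv_nth length_greater_0_conv)+
  have len: "length (hd (hconcat m (B # Bs))) = ?n + ?n'"
    using m by (simp add: hconcat_Cons hd_map hd0)
  have "cols (hconcat m (B # Bs))
      = map (\<lambda>j. map (\<lambda>i. (B ! i @ ?H ! i) ! j) [0..<m]) [0..<?n + ?n']"
    unfolding cols_def len by (simp add: hconcat_Cons)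
  also have "\<dots> = map (\<lambda>j. map (\<lambda>i. (B ! i @ ?H ! i) ! j) [0..<m]) [0..<?n]
      @ map (\<lambda>j. map (\<lambda>i. (B ! i @ ?H ! i) ! (j + ?n)) [0..<m]) [0..<?n']"
    by (rule nth_equalityI) (auto simp: nth_append)
  also have "\<dots> = cols B @ cols ?H"
    unfolding cols_def lB by (auto simp: nth_append rect_nth[OF B])
  finally show ?case using Cons by simp
qed

section \<open>Enumeration by rank\<close>

text \<open>For a strict total order the rank is strictly monotone, hence injective; it stays below
  \<open>card S\<close> because no element counts itself. Equal cardinalities give
  surjectivity.\<close>

lemma bij_betw_rank:
  assumes fin: "finite S" and irrefl: "\<And>x. \<not> r x x"
    and trans: "\<And>x y z. r x y \<Longrightarrow> r y z \<Longrightarrow> r x z"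
    and total: "\<And>x y. x \<noteq> y \<Longrightarrow> r x y \<or> r y x"
  shows "bij_betw (\<lambda>x. card {y \<in> S. r x y}) S {0..<card S}"
proof -
  let ?f = "\<lambda>x. card {y \<in> S. r x y}"
  have mono: "?f y < ?f x" if "r x y" "y \<in> S" for x y
  proof (rule psubset_card_mono)
    have "y \<in> {y \<in> S. r x y}" "y \<notin> {z \<in> S. r y z}" using that irrefl by auto
    moreover have "{z \<in> S. r y z} \<subseteq> {y \<in> S. r x y}" using that trans by auto
    ultimately show "{z \<in> S. r y z} \<subset> {y \<in> S. r x y}" by blast
  qed (use fin in auto)
  have "inj_on ?f S"
  proof (rule inj_onI, rule ccontr)
    fix x y assume "x \<in> S" "y \<in> S" "?f x = ?f y" "x \<noteq> y"
    then show False using total[of x y] mono[of x y] mono[of y x] by auto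
  qed
  moreover have "?f x < card S" if "x \<in> S" for x
    by (rule psubset_card_mono) (use fin that irrefl in auto)
  then have "?f ` S \<subseteq> {0..<card S}" by auto
  ultimately show ?thesis
    unfolding bij_betw_def using card_subset_eq[of "{0..<card S}" "?f ` S"] by (simp add: card_image)
qed

text \<open>The inverse of the rank bijection, in the shape of the definite descriptions behind
  \<open>rho\<close> and \<open>aelt\<close>.\<close>

lemma bij_betw_nth_smallest:
  assumes "finite S" and "\<And>x. \<not> r x x"
    and "\<And>x y z. r x y \<Longrightarrow> r y z \<Longrightarrow> r x z"
    and "\<And>x y. x \<noteq> y \<Longrightarrow> r x y \<or> r y x"
  shows "bij_betw (\<lambda>j. THE x. x \<in> S \<and> card {y \<in> S. r x y} = j) {0..<card S} S"
  using bij_betw_the_inv_into[OF bij_betw_rank[OF assms]]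
  by (simp add: the_inv_into_def)

lemma sum_list_upt_bij:
  assumes "bij_betw h {0..<n} S"
  shows "(\<Sum>j\<leftarrow>[0..<n]. f (h j)) = (\<Sum>x\<in>S. f x)"
  using sum.reindex_bij_betw[OF assms, of f] by (simp add: interv_sum_list_conv_sum_set_nat)

lemma sum_list_concat_map:
  fixes f :: "'b \<Rightarrow> 'c::comm_monoid_add"
  shows "(\<Sum>x\<leftarrow>concat (map h js). f x) = (\<Sum>j\<leftarrow>js. \<Sum>x\<leftarrow>h j. f x)"
  by (induction js) auto

section \<open>Hamming distance\<close>

lemma hdist_Cons:
  "hdist (a # xs) (b # ys) = (if a \<noteq> b then 1 else 0) + hdist xs ys"
proof -
  have eq: "{i. i < length (a # xs) \<and> (a # xs) ! i \<noteq> (b # ys) ! i}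
     = (if a \<noteq> b then {0} else {}) \<union> Suc ` {i. i < length xs \<and> xs ! i \<noteq> ys ! i}"
    by (auto simp: less_Suc_eq_0_disj image_iff)
  show ?thesis unfolding hdist_def eq
    by (subst card_Un_disjoint) (auto simp: card_image)
qed

lemma hdist_append:
  "length xs = length ys \<Longrightarrow> hdist (xs @ xs') (ys @ ys') = hdist xs ys + hdist xs' ys'"
  by (induction xs ys rule: list_induct2) (auto simp: hdist_Cons, simp add: hdist_def)

lemma hdist_map: "hdist (map f vs) (map h vs) = length (filter (\<lambda>v. f v \<noteq> h v) vs)"
  by (induction vs) (auto simp: hdist_Cons, simp add: hdist_def)

lemma hdist_concat_map:
  assumes "\<And>x y. length (f x) = length (f y)"
  shows "hdist (concat (map f (map a us))) (concat (map f (map b us)))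
       = (\<Sum>u\<leftarrow>us. hdist (f (a u)) (f (b u)))"
  by (induction us) (auto simp: hdist_append[OF assms], simp add: hdist_def)

lemma hdist_self_iff: "length x = length y \<Longrightarrow> hdist x y = 0 \<longleftrightarrow> x = y"
  by (auto simp: hdist_def list_eq_iff_nth_eq)

text \<open>A nonconstant affine form takes every value equally often. If a coefficient after the
  first is nonzero, fixing the first coordinate only changes the constant term; otherwise the form
  depends on the first coordinate alone and vanishes for exactly one value of it.\<close>

lemma sum_affine_form_nonzero:
  fixes d :: "nat \<Rightarrow> 'f::{field,finite}"
  assumes "\<exists>i<m. d i \<noteq> 0"
  shows "(\<Sum>v\<in>vecs UNIV m. if dot d v + b \<noteq> 0 then 1 else 0 :: nat)
       = (card (UNIV :: 'f set) - 1) * card (UNIV :: 'f set) ^ (m - 1)"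
  using assms
proof (induction m arbitrary: d b)
  case (Suc m)
  let ?q = "card (UNIV :: 'f set)" and ?d = "\<lambda>i. d (Suc i)"
  show ?case
  proof (cases "\<exists>i<m. ?d i \<noteq> 0")
    case True
    have "(\<Sum>v\<in>vecs UNIV m. if dot d (a # v) + b \<noteq> 0 then 1 else 0 :: nat)
        = (?q - 1) * ?q ^ (m - 1)" for a
      using Suc.IH[OF True, of "d 0 * a + b"] by (simp add: dot_Cons algebra_simps)
    moreover have "m > 0" using True by auto
    ultimately show ?thesis
      by (cases m) (simp_all add: sum_vecs_Suc)
  next
    case False
    then have d0: "d 0 \<noteq> 0" using Suc.prems by (metis less_Suc_eq_0_disj)
    have dot0: "dot ?d v = 0" if "v \<in> vecs UNIV m" for v
      using False that by (auto simp: dot_def vecs_def intro!: sum.neutral)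
    have "d 0 * a + b \<noteq> 0 \<longleftrightarrow> a \<noteq> - b / d 0" for a
      using d0 by (auto simp: field_simps eq_neg_iff_add_eq_0)
    then have "(\<Sum>v\<in>vecs UNIV m. if dot d (a # v) + b \<noteq> 0 then 1 else 0 :: nat)
        = (if a \<noteq> - b / d 0 then ?q ^ m else 0)" for a
      using dot0 by (simp add: dot_Cons card_vecs)
    then have "(\<Sum>v\<in>vecs UNIV (Suc m). if dot d v + b \<noteq> 0 then 1 else 0 :: nat)
       = (\<Sum>a\<in>UNIV. if a \<noteq> - b / d 0 then ?q ^ m else 0)"
      by (simp add: sum_vecs_Suc)
    also have "\<dots> = (\<Sum>a\<in>UNIV - {- b / d 0}. ?q ^ m)"
      by (rule sum.mono_neutral_cong_right) auto
    finally show ?thesis by (simp add: card_Diff_singleton)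
  qed
qed simp

section \<open>Finite chain rings and the homogeneous weight\<close>

text \<open>\<open>p\<close> is the residue map and \<open>e\<close> lists the coset
  representatives. \<open>s2\<close> excludes fields: for \<open>s = 1\<close> all nonzero codewords
  have the same weight, and the smaller of the two weights in the theorem does not occur.\<close>

locale finite_chain_ring =
  fixes g :: "'a::{comm_ring_1,finite}"
    and p :: "'a \<Rightarrow> 'f::{field,finite}"
    and e :: "nat \<Rightarrow> 'a"
    and s q :: nat
  assumes q: "q = card (UNIV :: 'f set)"
    and hom: "is_ring_hom p" and surj: "surj p"
    and ker: "{x. p x = 0} = pideal g"
    and nil: "g ^ s = 0" and least: "\<forall>t<s. g ^ t \<noteq> 0"
    and s2: "2 \<le> s"
    and e0: "e 0 = 0"
    and reps: "bij_betw (p \<circ> e) {0..<q} UNIV"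
begin

section \<open>Units, powers of the generator and the socle\<close>

lemma pideal_dvd: "pideal g = {x. g dvd x}"
  by (auto simp: pideal_def dvd_def)

lemma p_zero_iff: "p x = 0 \<longleftrightarrow> g dvd x"
  using ker by (auto simp: pideal_dvd)

lemma p_add: "p (x + y) = p x + p y" and p_mult: "p (x * y) = p x * p y" and p_1: "p 1 = 1"
  using hom by (auto simp: is_ring_hom_def)

lemma p_diff: "p (x - y) = p x - p y"
  using p_add[of "x - y" y] by simp

lemma q_ge_2: "2 \<le> q"
proof -
  have "card {0, 1 :: 'f} \<le> q" unfolding q by (rule card_mono) auto
  then show ?thesis by simp
qed

text \<open>Lifting the inverse of \<open>p x\<close> gives \<open>y\<close> with
  \<open>x * y = 1 - g * r\<close>; since \<open>g * r\<close> is nilpotent, a finite geometric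
  series inverts this element.\<close>

lemma unit_iff: "x dvd 1 \<longleftrightarrow> p x \<noteq> 0"
proof
  assume "x dvd 1"
  then obtain y where "1 = x * y" by (auto simp: dvd_def)
  then show "p x \<noteq> 0" using p_1 p_mult by (metis mult_zero_left zero_neq_one)
next
  assume "p x \<noteq> 0"
  obtain y where y: "p y = inverse (p x)" using surj by (metis surjD)
  have "p (1 - x * y) = 0" using \<open>p x \<noteq> 0\<close> y by (simp add: p_diff p_mult p_1)
  then obtain r where r: "1 - x * y = g * r" by (auto simp: p_zero_iff dvd_def)
  have "1 = 1 - (g * r) ^ s" by (simp add: power_mult_distrib nil)
  also have "\<dots> = (1 - g * r) * (\<Sum>i<s. (g * r) ^ i)" by (rule one_diff_power_eq)
  also have "1 - g * r = x * y" using r by (simp add: algebra_simps)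
  finally show "x dvd 1" by (metis dvd_triv_left mult.assoc)
qed

lemma power_zero_iff: "g ^ i = 0 \<longleftrightarrow> s \<le> i"
proof
  show "s \<le> i" if "g ^ i = 0" using that least not_le by blast
  show "g ^ i = 0" if "s \<le> i" using le_imp_power_dvd[OF that, of g] nil by simp
qed

lemma power_mult_unit_zero_iff: "u dvd 1 \<Longrightarrow> g ^ i * u = 0 \<longleftrightarrow> s \<le> i"
proof -
  assume "u dvd 1"
  then obtain u' where "1 = u * u'" by (rule dvdE)
  then have "g ^ i = g ^ i * u * u'" by (simp add: mult.assoc)
  then have "g ^ i * u = 0 \<longleftrightarrow> g ^ i = 0" by auto
  then show ?thesis by (simp add: power_zero_iff)
qed

lemma power_mult_zero_imp_dvd:
  assumes "i < s" "g ^ i * x = 0"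
  shows "g dvd x"
proof (rule ccontr)
  assume "\<not> g dvd x"
  then have "x dvd 1" by (simp add: unit_iff p_zero_iff)
  from power_mult_unit_zero_iff[OF this] assms show False by simp
qed

text \<open>Factors \<open>g\<close> are split off until the cofactor is a unit. This happens before
  exponent \<open>s\<close>, as otherwise \<open>g ^ s = 0\<close> would divide
  \<open>x\<close>.\<close>

lemma nonzero_decomp:
  assumes "x \<noteq> 0"
  obtains i u where "i < s" "u dvd 1" "x = g ^ i * u"
proof -
  have "g ^ n dvd x \<or> (\<exists>i<n. \<exists>u. u dvd 1 \<and> x = g ^ i * u)" for n
  proof (induction n)
    case (Suc n)
    show ?case
    proof (cases "\<exists>i<n. \<exists>u. u dvd 1 \<and> x = g ^ i * u")
      case True
      then show ?thesis using less_Suc_eq by blast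
    next
      case False
      then obtain y where y: "x = g ^ n * y" using Suc by (auto simp: dvd_def)
      show ?thesis
      proof (cases "y dvd 1")
        case False
        then have "g dvd y" by (simp add: unit_iff p_zero_iff)
        then have "g ^ n * g dvd g ^ n * y" by (intro mult_dvd_mono) auto
        then show ?thesis using y by (simp add: mult.commute)
      qed (use y in blast)
    qed
  qed simp
  from this[of s] show ?thesis using assms that nil by auto
qed

text \<open>The annihilator of \<open>g\<close> is the socle. In \<open>x = g ^ i * u\<close> with
  \<open>u\<close> a unit and \<open>i < s\<close>, one more factor \<open>g\<close> gives zero only
  for \<open>i = s - 1\<close>.\<close>

lemma annihilator_iff: "g * x = 0 \<longleftrightarrow> g ^ (s - 1) dvd x"
proof
  assume gx: "g * x = 0"
  show "g ^ (s - 1) dvd x"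
  proof (cases "x = 0")
    case False
    then obtain i u where iu: "i < s" "u dvd 1" "x = g ^ i * u" by (rule nonzero_decomp)
    then have "s \<le> Suc i" using gx power_mult_unit_zero_iff[of u "Suc i"] by (simp add: mult.assoc)
    then have "i = s - 1" using iu by simp
    then show ?thesis using iu by simp
  qed simp
next
  assume "g ^ (s - 1) dvd x"
  then obtain y where "x = g ^ (s - 1) * y" by (auto simp: dvd_def)
  then have "g * x = g ^ Suc (s - 1) * y" by (simp add: mult.assoc)
  then show "g * x = 0" using s2 nil by simp
qed

section \<open>Coset representatives and the sizes of the ideals\<close>

lemma rep_inj: "i < q \<Longrightarrow> j < q \<Longrightarrow> p (e i) = p (e j) \<Longrightarrow> i = j"
  using reps by (auto simp: bij_betw_def inj_on_def)

lemma rep_ex: obtains j where "j < q" "g dvd x - e j"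
proof -
  have "p x \<in> (p \<circ> e) ` {0..<q}" using reps by (simp add: bij_betw_def)
  then obtain j where "j < q" "p (e j) = p x" by auto
  then show ?thesis using that p_diff[of x "e j"] by (simp add: p_zero_iff)
qed

lemma power_mult_rep_diff:
  assumes "i < s" "j < q" "j' < q" "g ^ Suc i dvd g ^ i * (e j - e j')"
  shows "j = j'"
proof -
  obtain z where "g ^ i * (e j - e j') = g ^ Suc i * z" using assms by (auto simp: dvd_def)
  then have "g ^ i * (e j - e j' - g * z) = 0" by (simp add: algebra_simps)
  then have "g dvd e j - e j' - g * z" using assms power_mult_zero_imp_dvd by blast
  then have "p (e j - e j' - g * z) = 0" by (simp add: p_zero_iff)
  moreover have "p (g * z) = 0" by (simp add: p_zero_iff)
  ultimately have "p (e j) = p (e j')" by (simp add: p_diff)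
  then show ?thesis using assms rep_inj by blast
qed

text \<open>Consecutive ideals of the chain have index \<open>q\<close>: each multiple of
  \<open>g ^ m\<close> is \<open>g ^ m * e j + z\<close> for exactly one \<open>j < q\<close> and
  one multiple \<open>z\<close> of \<open>g ^ Suc m\<close>. The induction descends from the zero
  ideal at \<open>m = s\<close>.\<close>

lemma card_power_multiples: "m \<le> s \<Longrightarrow> card {x. g ^ m dvd x} = q ^ (s - m)"
proof (induction "s - m" arbitrary: m)
  case 0
  then have "m = s" by simp
  then show ?case by (simp add: nil)
next
  case (Suc n)
  then have m: "m < s" by simp
  let ?f = "\<lambda>(j, z). g ^ m * e j + z"
  have inj: "inj_on ?f ({0..<q} \<times> {x. g ^ Suc m dvd x})"
  proof (rule inj_onI, clarsimp)
    fix j z j' z'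
    assume *: "j < q" "j' < q" "g * g ^ m dvd z" "g * g ^ m dvd z'"
      "g ^ m * e j + z = g ^ m * e j' + z'"
    then have "g ^ m * (e j - e j') = z' - z" by (simp add: algebra_simps)
    then have "g ^ Suc m dvd g ^ m * (e j - e j')" using * by (simp add: dvd_diff)
    then have "j = j'" using * m power_mult_rep_diff by blast
    then show "j = j' \<and> z = z'" using * by simp
  qed
  have img: "?f ` ({0..<q} \<times> {x. g ^ Suc m dvd x}) = {x. g ^ m dvd x}"
  proof (intro equalityI subsetI)
    fix x assume "x \<in> {x. g ^ m dvd x}"
    then obtain r where r: "x = g ^ m * r" by (auto simp: dvd_def)
    obtain j where j: "j < q" "g dvd r - e j" by (rule rep_ex)
    then have "g ^ m * g dvd g ^ m * (r - e j)" by (rule_tac mult_dvd_mono) auto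
    then have "x = ?f (j, g ^ m * (r - e j))" "g ^ Suc m dvd g ^ m * (r - e j)"
      using r by (simp_all add: algebra_simps)
    then show "x \<in> ?f ` ({0..<q} \<times> {x. g ^ Suc m dvd x})" using j by force
  qed (auto intro: dvd_add dvd_mult_right)
  have "card {x. g ^ m dvd x} = q * card {x. g ^ Suc m dvd x}"
    using card_image[OF inj] unfolding img by (simp add: card_cartesian_product)
  also have "card {x. g ^ Suc m dvd x} = q ^ (s - Suc m)"
    using Suc m by (intro Suc.hyps(1)) auto
  also have "q * q ^ (s - Suc m) = q ^ (s - m)"
    using m by (metis Suc_diff_Suc power_Suc)
  finally show ?case .
qed

lemma card_ring: "card (UNIV :: 'a set) = q ^ s"
  using card_power_multiples[of 0] by simp

lemma card_maximal_ideal: "card {x. g dvd x} = q ^ (s - 1)"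
  using card_power_multiples[of 1] s2 by simp

lemma card_annihilator: "card {x. g * x = 0} = q"
  using card_power_multiples[of "s - 1"] s2 by (simp add: annihilator_iff)

lemma card_units: "card {t :: 'a. t dvd 1} = q ^ s - q ^ (s - 1)"
proof -
  have "{t :: 'a. t dvd 1} = UNIV - {x. g dvd x}" by (auto simp: unit_iff p_zero_iff)
  then show ?thesis by (simp add: card_Diff_subset card_ring card_maximal_ideal)
qed

text \<open>The homogeneous weight, scaled to match the first order Reed-Muller code:
  \<open>q ^ (s - 1)\<close> is the weight of a nonzero constant word,
  \<open>(q - 1) * q ^ (s - 2)\<close> that of a nonconstant affine form.\<close>

definition homw :: "'a \<Rightarrow> nat" where
  "homw x = (if x = 0 then 0 else if g * x = 0 then q ^ (s - 1) else (q - 1) * q ^ (s - 2))"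

lemma homw_unit: "t dvd 1 \<Longrightarrow> homw (t * x) = homw x"
proof -
  assume "t dvd 1"
  then obtain t' where t': "t * t' = 1" by (auto elim: dvdE)
  have "t * y = 0 \<longleftrightarrow> y = 0" for y
  proof
    have "y = t' * (t * y)" using t' by (simp add: mult.assoc[symmetric] mult.commute)
    then show "t * y = 0 \<Longrightarrow> y = 0" by simp
  qed simp
  from this[of x] this[of "g * x"] show ?thesis by (simp add: homw_def mult.left_commute)
qed

lemma q_powers: "q ^ s = q * (q * q ^ (s - 2))" "q ^ (s - 1) = q * q ^ (s - 2)"
proof -
  obtain r where "s = Suc (Suc r)" using s2 by (metis add_2_eq_Suc le_Suc_ex)
  then show "q ^ s = q * (q * q ^ (s - 2))" "q ^ (s - 1) = q * q ^ (s - 2)" by simp_all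
qed

text \<open>Outside the socle all weights in the coset agree. Otherwise the coset is the socle,
  where \<open>q - 1\<close> of the \<open>q\<close> elements have weight
  \<open>q ^ (s - 1)\<close>. Letting \<open>t\<close> run over the whole ring counts every element
  of the coset \<open>q ^ (s - 1)\<close> times.\<close>

lemma sum_homw_socle_coset:
  "(\<Sum>t\<in>UNIV. homw (y + g ^ (s - 1) * t)) = q ^ s * ((q - 1) * q ^ (s - 2))"
proof -
  have gs: "g * (g ^ (s - 1) * t) = 0" for t
    by (simp add: annihilator_iff)
  show ?thesis
  proof (cases "g * y = 0")
    case False
    have "homw (y + g ^ (s - 1) * t) = (q - 1) * q ^ (s - 2)" for t
    proof -
      have "g * (y + g ^ (s - 1) * t) = g * y" using gs[of t] by (simp add: distrib_left)
      then show ?thesis using False by (metis homw_def mult_zero_right)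
    qed
    then show ?thesis by (simp add: card_ring)
  next
    case True
    then obtain z where z: "y = g ^ (s - 1) * z" by (auto simp: annihilator_iff dvd_def)
    have zero: "g ^ (s - 1) * t = 0 \<longleftrightarrow> g dvd t" for t
    proof
      show "g dvd t" if "g ^ (s - 1) * t = 0"
        using power_mult_zero_imp_dvd[OF _ that] s2 by simp
      show "g ^ (s - 1) * t = 0" if "g dvd t"
        using that gs by (metis dvdE mult.left_commute)
    qed
    have "(\<Sum>t\<in>UNIV. homw (y + g ^ (s - 1) * t)) = (\<Sum>t\<in>UNIV. homw (g ^ (s - 1) * (z + t)))"
      by (simp add: z distrib_left)
    also have "\<dots> = (\<Sum>t\<in>UNIV. homw (g ^ (s - 1) * t))"
      by (rule sum.reindex_bij_witness[of _ "\<lambda>t. t - z" "\<lambda>t. z + t"]) auto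
    also have "\<dots> = (\<Sum>t\<in>UNIV - {x. g dvd x}. q ^ (s - 1))"
      by (rule sum.mono_neutral_cong_right) (use zero gs in \<open>auto simp: homw_def\<close>)
    also have "\<dots> = (q ^ s - q ^ (s - 1)) * q ^ (s - 1)"
      by (simp add: card_Diff_subset card_ring card_maximal_ideal)
    also have "\<dots> = q ^ s * ((q - 1) * q ^ (s - 2))"
      unfolding q_powers by (simp add: algebra_simps diff_mult_distrib2)
    finally show ?thesis .
  qed
qed

text \<open>A nonzero ideal \<open>c J\<close> contains the socle, so translating \<open>z\<close> and averaging over all
  translates that move \<open>c z\<close> within the socle reduces the sum to a single socle coset.\<close>
lemma sum_homw_ideal_coset:
  assumes J: "is_ideal J" and a: "a \<in> J" "c * a \<noteq> 0"
  shows "(\<Sum>z\<in>J. homw (x + c * z)) = card J * ((q - 1) * q ^ (s - 2))"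
proof -
  let ?W = "(q - 1) * q ^ (s - 2)"
  obtain i u where iu: "i < s" "u dvd 1" "c * a = g ^ i * u" by (rule nonzero_decomp[OF a(2)])
  obtain u' where u': "u * u' = 1" using iu(2) by (auto elim: dvdE)
  \<comment> \<open>The factors are chosen so that \<open>c * h = g ^ (s - 1)\<close>:
    \<open>u'\<close> cancels the unit in \<open>c * a = g ^ i * u\<close>, and the power of
    \<open>g\<close> fills up the exponent.\<close>
  define h where "h = u' * g ^ (s - 1 - i) * a"
  have mJ: "r * y \<in> J" if "y \<in> J" for r y using J that by (auto simp: is_ideal_def)
  have h: "h \<in> J" unfolding h_def using a mJ by blast
  have "c * h = (c * a) * u' * g ^ (s - 1 - i)" by (simp add: h_def mult_ac)
  also have "\<dots> = (u * u') * (g ^ i * g ^ (s - 1 - i))" unfolding iu(3) by (simp add: mult_ac)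
  also have "\<dots> = g ^ (s - 1)" using u' iu(1) by (simp flip: power_add)
  finally have ch: "c * h = g ^ (s - 1)" .
  have shift: "(\<Sum>z\<in>J. homw (x + c * z)) = (\<Sum>z\<in>J. homw ((x + c * z) + g ^ (s - 1) * t))" for t
  proof -
    have th: "t * h \<in> J" "- t * h \<in> J" using h mJ by blast+
    have ad: "y + z \<in> J" if "y \<in> J" "z \<in> J" for y z using J that by (auto simp: is_ideal_def)
    show ?thesis
    proof (rule sum.reindex_bij_witness[of _ "\<lambda>z. z + t * h" "\<lambda>z. z + - t * h"])
      fix z
      show "homw (x + c * (z + - t * h) + g ^ (s - 1) * t) = homw (x + c * z)"
        unfolding ch[symmetric] by (simp add: algebra_simps)
      show "z + - t * h \<in> J" if "z \<in> J" using that th ad by blast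
    qed (use th ad in auto)
  qed
  have "q ^ s * (\<Sum>z\<in>J. homw (x + c * z)) = (\<Sum>t::'a\<in>UNIV. \<Sum>z\<in>J. homw (x + c * z))"
    by (simp add: card_ring)
  also have "\<dots> = (\<Sum>t\<in>UNIV. \<Sum>z\<in>J. homw ((x + c * z) + g ^ (s - 1) * t))"
    by (rule sum.cong[OF refl shift])
  also have "\<dots> = (\<Sum>z\<in>J. \<Sum>t\<in>UNIV. homw ((x + c * z) + g ^ (s - 1) * t))"
    by (rule sum.swap)
  also have "\<dots> = q ^ s * (card J * ?W)"
    unfolding sum_homw_socle_coset by simp
  finally show ?thesis using q_ge_2 by simp
qed

text \<open>One coordinate whose coefficient does not annihilate \<open>J\<close> is enough. The
  contribution of the first entry is absorbed into the translate \<open>x\<close>, which is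
  therefore arbitrary in the induction; if only the first coordinate acts, the sum reduces to the
  coset sum over \<open>J\<close>.\<close>

lemma sum_homw_dot:
  assumes J: "is_ideal J" and "\<exists>i<k. \<exists>a\<in>J. c i * a \<noteq> 0"
  shows "(\<Sum>u\<in>vecs J k. homw (x + dot c u)) = card J ^ k * ((q - 1) * q ^ (s - 2))"
  using assms(2)
proof (induction k arbitrary: c x)
  case (Suc k)
  show ?case
  proof (cases "\<exists>i<k. \<exists>a\<in>J. c (Suc i) * a \<noteq> 0")
    case True
    from Suc.IH[OF True] show ?thesis by (simp add: sum_vecs_Suc dot_Cons flip: add.assoc)
  next
    case False
    then obtain a where a: "a \<in> J" "c 0 * a \<noteq> 0" using Suc.prems by (metis less_Suc_eq_0_disj)
    have "dot (\<lambda>i. c (Suc i)) u = 0" if "u \<in> vecs J k" for u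
      using that False by (force simp: vecs_def dot_def intro!: sum.neutral)
    then have "(\<Sum>u\<in>vecs J (Suc k). homw (x + dot c u))
        = (\<Sum>z\<in>J. card (vecs J k) * homw (x + c 0 * z))"
      by (simp add: sum_vecs_Suc dot_Cons)
    also have "\<dots> = card (vecs J k) * (card J * ((q - 1) * q ^ (s - 2)))"
      using sum_homw_ideal_coset[OF J a, of x] by (simp flip: sum_distrib_left)
    finally show ?thesis by (simp add: card_vecs)
  qed
qed simp

section \<open>Digits and the Gray map\<close>

abbreviation dig :: "'a \<Rightarrow> nat \<Rightarrow> nat" where
  "dig \<equiv> digit g s e q"

text \<open>If the lowest \<open>m\<close> digits agree, all terms from \<open>Suc m\<close> on are
  multiples of \<open>g ^ Suc m\<close>, so digit \<open>m\<close> alone decides the next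
  divisibility. At \<open>m = s\<close> this is the uniqueness of the representation.\<close>

lemma adic_agree:
  assumes "m \<le> s" "\<forall>i<s. d i < q" "\<forall>i<s. d' i < q"
  shows "g ^ m dvd (\<Sum>i<s. e (d i) * g ^ i) - (\<Sum>i<s. e (d' i) * g ^ i) \<longleftrightarrow> (\<forall>i<m. d i = d' i)"
  using assms(1)
proof (induction m)
  case (Suc m)
  let ?D = "(\<Sum>i<s. e (d i) * g ^ i) - (\<Sum>i<s. e (d' i) * g ^ i)"
  have key: "g ^ Suc m dvd ?D \<longleftrightarrow> d m = d' m" if eq: "\<forall>i<m. d i = d' i"
  proof -
    let ?f = "\<lambda>i. (e (d i) - e (d' i)) * g ^ i"
    have "?D = (\<Sum>i<s. ?f i)" by (simp add: left_diff_distrib sum_subtractf)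
    also have "\<dots> = (\<Sum>i=m..<s. ?f i)"
      by (rule sum.mono_neutral_right) (use eq in auto)
    finally have D: "?D = ?f m + (\<Sum>i\<in>{Suc m..<s}. ?f i)"
      using Suc.prems by (simp add: sum.atLeast_Suc_lessThan)
    have "g ^ Suc m dvd (\<Sum>i\<in>{Suc m..<s}. ?f i)"
      by (intro dvd_sum dvd_mult le_imp_power_dvd) auto
    then have "g ^ Suc m dvd ?D \<longleftrightarrow> g ^ Suc m dvd ?f m"
      unfolding D by (simp add: dvd_add_left_iff)
    also have "\<dots> \<longleftrightarrow> d m = d' m"
      using power_mult_rep_diff[of m "d m" "d' m"] assms Suc.prems by (auto simp: mult.commute)
    finally show ?thesis .
  qed
  have weaken: "g ^ m dvd ?D" if "g ^ Suc m dvd ?D"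
    using le_imp_power_dvd[of m "Suc m" g] that by (rule_tac dvd_trans) auto
  have IH: "g ^ m dvd ?D \<longleftrightarrow> (\<forall>i<m. d i = d' i)" by (rule Suc.IH[OF Suc_leD[OF Suc.prems]])
  show ?case
  proof (cases "\<forall>i<m. d i = d' i")
    case True
    then show ?thesis using key less_Suc_eq by metis
  next
    case False
    then show ?thesis using weaken IH less_Suc_eq by blast
  qed
qed simp

text \<open>Successive approximation: the remainder is \<open>g ^ n * z\<close>, and the next digit
  is the representative of the class of \<open>z\<close>.\<close>

lemma adic_ex: "\<exists>d. (\<forall>i. d i < q) \<and> g ^ n dvd x - (\<Sum>i<n. e (d i) * g ^ i)"
proof (induction n)
  case 0
  show ?case using q_ge_2 by (intro exI[of _ "\<lambda>_. 0"]) auto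
next
  case (Suc n)
  then obtain d z where d: "\<forall>i. d i < q" "x - (\<Sum>i<n. e (d i) * g ^ i) = g ^ n * z"
    by (auto simp: dvd_def)
  obtain j where j: "j < q" "g dvd z - e j" by (rule rep_ex)
  have "x - (\<Sum>i<Suc n. e ((d(n := j)) i) * g ^ i) = g ^ n * (z - e j)"
    using d by (simp add: algebra_simps)
  moreover have "g ^ n * g dvd g ^ n * (z - e j)" using j by (intro mult_dvd_mono) auto
  ultimately show ?case using d j by (intro exI[of _ "d(n := j)"]) (auto simp: mult.commute)
qed

lemma digit_spec:
  "(\<forall>i<s. dig x i < q) \<and> (\<forall>i\<ge>s. dig x i = 0) \<and> x = (\<Sum>i<s. e (dig x i) * g ^ i)"
proof -
  obtain d where d: "\<forall>i. d i < q" "x = (\<Sum>i<s. e (d i) * g ^ i)"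
    using adic_ex[of s x] nil by auto
  \<comment> \<open>The value 0 from index \<open>s\<close> on is prescribed by the definition of
    \<open>digit\<close>, so that the digit function is unique on all naturals.\<close>
  let ?d = "\<lambda>i. if i < s then d i else 0"
  have "\<exists>!d. (\<forall>i<s. d i < q) \<and> (\<forall>i\<ge>s. d i = 0) \<and> x = (\<Sum>i<s. e (d i) * g ^ i)"
  proof (rule ex1I[of _ ?d])
    fix d' assume *: "(\<forall>i<s. d' i < q) \<and> (\<forall>i\<ge>s. d' i = 0) \<and> x = (\<Sum>i<s. e (d' i) * g ^ i)"
    have "(\<Sum>i<s. e (d' i) * g ^ i) - (\<Sum>i<s. e (d i) * g ^ i) = 0" using * d by simp
    then have "\<forall>i<s. d' i = d i"
      using adic_agree[of s d' d] * d by (simp add: nil)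
    then show "d' = ?d" using * by (auto simp: fun_eq_iff)
  qed (use d in auto)
  then show ?thesis unfolding digit_def by (rule theI')
qed

lemma digits_agree: "m \<le> s \<Longrightarrow> (\<forall>i<m. dig x i = dig y i) \<longleftrightarrow> g ^ m dvd x - y"
  using adic_agree[of m "dig x" "dig y"] digit_spec[of x, THEN conjunct1]
    digit_spec[of y, THEN conjunct1]
  by (simp flip: digit_spec[THEN conjunct2, THEN conjunct2])

lemma digits_eq: "(\<forall>i<s. dig x i = dig y i) \<Longrightarrow> x = y"
  using digits_agree[of s x y] by (simp add: nil)

lemma digit_zero: "dig 0 i = 0"
proof (cases "i < s")
  case True
  have "(\<Sum>i<s. e (dig 0 i) * g ^ i) = 0" by (rule digit_spec[of 0, THEN conjunct2, THEN conjunct2, symmetric])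
  moreover have "\<forall>i<s. dig 0 i < q" using digit_spec by blast
  ultimately show ?thesis using adic_agree[of s "dig 0" "\<lambda>_. 0"] True q_ge_2 by (simp add: e0)
next
  case False
  then show ?thesis using digit_spec not_le by blast
qed

text \<open>Lexicographic comparison from the highest digit. For transitivity the larger of the two
  deciding positions decides; for totality, the highest position with different digits.\<close>

lemma gtR_order:
  "\<not> gtR g s e q x x"
  "gtR g s e q x y \<Longrightarrow> gtR g s e q y z \<Longrightarrow> gtR g s e q x z"
  "x \<noteq> y \<Longrightarrow> gtR g s e q x y \<or> gtR g s e q y x"
proof -
  show "\<not> gtR g s e q x x" by (auto simp: gtR_def)
next
  assume "gtR g s e q x y" "gtR g s e q y z"
  then obtain i i' where i: "i < s" "dig x i > dig y i" "\<And>j. i < j \<Longrightarrow> j < s \<Longrightarrow> dig x j = dig y j"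
    and i': "i' < s" "dig y i' > dig z i'" "\<And>j. i' < j \<Longrightarrow> j < s \<Longrightarrow> dig y j = dig z j"
    by (auto simp: gtR_def)
  have "dig x (max i i') > dig z (max i i')"
    using i(1,2) i(3)[of i'] i'(1,2) i'(3)[of i] by (cases i i' rule: linorder_cases) auto
  then show "gtR g s e q x z"
    unfolding gtR_def using i i' by (intro exI[of _ "max i i'"]) auto
next
  assume "x \<noteq> y"
  let ?A = "{i. i < s \<and> dig x i \<noteq> dig y i}"
  have A: "?A \<noteq> {}" "finite ?A" using digits_eq \<open>x \<noteq> y\<close> by auto
  define M where "M = Max ?A"
  have M: "M < s" "dig x M \<noteq> dig y M" using Max_in[OF A(2,1)] unfolding M_def by auto
  have above: "dig x j = dig y j" if "M < j" "j < s" for j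
    using Max_ge[OF A(2), of j] that unfolding M_def[symmetric] by auto
  from M(2) consider "dig x M > dig y M" | "dig y M > dig x M" by linarith
  then show "gtR g s e q x y \<or> gtR g s e q y x"
  proof cases
    case 1
    then have "gtR g s e q x y" using M above by (auto simp: gtR_def)
    then show ?thesis ..
  next
    case 2
    then have "gtR g s e q y x" using M above by (auto simp: gtR_def)
    then show ?thesis ..
  qed
qed

lemma bij_rho: "bij_betw (rho g s e q) {0..<q ^ s} UNIV"
  using bij_betw_nth_smallest[of UNIV "gtR g s e q", OF _ gtR_order]
  by (simp add: card_ring rho_def[abs_def])

lemma bij_aelt: "bij_betw (aelt g s e q) {0..<q ^ (s - 1)} {x. g dvd x}"
  using bij_betw_nth_smallest[of "pideal g" "gtR g s e q", OF _ gtR_order]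
  by (simp add: card_maximal_ideal aelt_def[abs_def] pideal_dvd)

text \<open>The digits of \<open>x - y\<close> need not be differences of digits, yet the two images
  differ by an affine form whose coefficients are the differences of residue digits. Its type
  depends only on \<open>x - y\<close>: the lowest \<open>s - 1\<close> digits agree exactly when
  \<open>g ^ (s - 1)\<close> divides \<open>x - y\<close>, that is, when
  \<open>g * (x - y) = 0\<close>.\<close>

lemma hdist_gray:
  assumes "distinct vs" "set vs = {v :: 'f list. length v = s - 1}"
  shows "hdist (gray p g s e q vs x) (gray p g s e q vs y) = homw (x - y)"
proof -
  let ?d = "\<lambda>i. p (e (dig x i)) - p (e (dig y i))"
  let ?P = "\<lambda>v. dot ?d v + ?d (s - 1) \<noteq> 0"
  have vs: "set vs = vecs UNIV (s - 1)" using assms by (simp add: vecs_def)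
  have "hdist (gray p g s e q vs x) (gray p g s e q vs y)
      = length (filter (\<lambda>v. (\<Sum>i<s - 1. p (e (dig x i)) * v ! i) + p (e (dig x (s - 1)))
          \<noteq> (\<Sum>i<s - 1. p (e (dig y i)) * v ! i) + p (e (dig y (s - 1)))) vs)"
    unfolding gray_def by (rule hdist_map)
  also have "\<dots> = length (filter ?P vs)"
  proof (intro arg_cong[of _ _ length] filter_cong refl)
    fix v assume "v \<in> set vs"
    then have "length v = s - 1" using assms by simp
    then have "dot ?d v = (\<Sum>i<s - 1. p (e (dig x i)) * v ! i) - (\<Sum>i<s - 1. p (e (dig y i)) * v ! i)"
      by (simp add: dot_def left_diff_distrib sum_subtractf)
    then have "dot ?d v + ?d (s - 1) = ((\<Sum>i<s - 1. p (e (dig x i)) * v ! i) + p (e (dig x (s - 1))))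
          - ((\<Sum>i<s - 1. p (e (dig y i)) * v ! i) + p (e (dig y (s - 1))))"
      by simp
    then show "((\<Sum>i<s - 1. p (e (dig x i)) * v ! i) + p (e (dig x (s - 1)))
          \<noteq> (\<Sum>i<s - 1. p (e (dig y i)) * v ! i) + p (e (dig y (s - 1)))) \<longleftrightarrow> ?P v"
      by (simp only: right_minus_eq)
  qed
  also have "\<dots> = card (set (filter ?P vs))"
    using assms(1) by (simp add: distinct_card del: set_filter)
  also have "\<dots> = (\<Sum>v\<in>vecs UNIV (s - 1). if ?P v then 1 else 0)"
    by (simp add: vs sum.If_cases finite_vecs Int_def)
  finally have *: "hdist (gray p g s e q vs x) (gray p g s e q vs y)
      = (\<Sum>v\<in>vecs UNIV (s - 1). if ?P v then 1 else 0)" .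
  have lt: "dig z i < q" if "i < s" for z i using digit_spec that by blast
  have d0: "?d i = 0 \<longleftrightarrow> dig x i = dig y i" if "i < s" for i
    using rep_inj[OF lt[OF that] lt[OF that]] by auto
  have socle: "(\<forall>i<s - 1. dig x i = dig y i) \<longleftrightarrow> g * (x - y) = 0"
    using digits_agree[of "s - 1" x y] by (simp add: annihilator_iff)
  show ?thesis
  proof (cases "\<forall>i<s - 1. dig x i = dig y i")
    case True
    then have "dot ?d v = 0" if "v \<in> vecs UNIV (s - 1)" for v
      using that by (auto simp: dot_def vecs_def intro!: sum.neutral)
    then have "(\<Sum>v\<in>vecs UNIV (s - 1). if ?P v then 1 else 0 :: nat)
        = (if ?d (s - 1) \<noteq> 0 then q ^ (s - 1) else 0)"
      by (simp add: card_vecs q)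
    moreover have "?d (s - 1) \<noteq> 0 \<longleftrightarrow> x \<noteq> y"
    proof -
      have "x = y" if "dig x (s - 1) = dig y (s - 1)"
      proof (rule digits_eq, intro allI impI)
        fix i assume "i < s"
        then have "i < s - 1 \<or> i = s - 1" by linarith
        then show "dig x i = dig y i" using True that by auto
      qed
      then show ?thesis using d0[of "s - 1"] s2 by auto
    qed
    ultimately show ?thesis using True socle by (simp add: * homw_def)
  next
    case False
    then have "\<exists>i<s - 1. ?d i \<noteq> 0" using d0 by auto
    from sum_affine_form_nonzero[OF this, of "?d (s - 1)"]
    have "hdist (gray p g s e q vs x) (gray p g s e q vs y) = (q - 1) * q ^ (s - 1 - 1)"
      unfolding * q[symmetric] .
    moreover have "homw (x - y) = (q - 1) * q ^ (s - 2)"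
      using False socle by (metis homw_def mult_zero_right)
    ultimately show ?thesis by (simp add: numeral_2_eq_2)
  qed
qed

section \<open>The columns of the generator matrices\<close>

lemma rect_Galpha: "rect (Suc k) (Galpha g s e q (Suc k))"
proof (induction k)
  case (Suc k)
  then show ?case by (auto intro!: rect_hconcat rect_block)
qed (simp add: rect_def)

lemma rect_Gbeta: "rect (Suc k) (Gbeta g s e q (Suc k))"
proof (induction k)
  case (Suc k)
  then show ?case using rect_Galpha by (auto intro!: rect_hconcat rect_block)
qed (simp add: rect_def)

lemma cols_Galpha_Suc:
  "cols (Galpha g s e q (Suc (Suc k)))
     = concat (map (\<lambda>j. map ((#) (rho g s e q j)) (cols (Galpha g s e q (Suc k)))) [0..<q ^ s])"
  using rect_block[OF rect_Galpha] by (simp add: cols_hconcat comp_def cols_block)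

lemma cols_Gbeta_Suc:
  "cols (Gbeta g s e q (Suc (Suc k))) = map ((#) 1) (cols (Galpha g s e q (Suc k)))
     @ concat (map (\<lambda>j. map ((#) (aelt g s e q j)) (cols (Gbeta g s e q (Suc k)))) [0..<q ^ (s - 1)])"
  using rect_block[OF rect_Galpha] rect_block[OF rect_Gbeta]
  by (simp add: cols_hconcat comp_def cols_block)

text \<open>The columns of the alpha matrix run through all vectors of their length, each once.
  Equality of sums for every \<open>f\<close> expresses this with multiplicities.\<close>

lemma sum_cols_Galpha:
  "(\<Sum>u\<leftarrow>cols (Galpha g s e q (Suc k)). f u) = sum f (vecs UNIV (Suc k))"
proof (induction k arbitrary: f)
  case 0
  have "cols (Galpha g s e q (Suc 0)) = map (\<lambda>j. [rho g s e q j]) [0..<q ^ s]"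
    by (simp add: cols_def)
  then show ?case using sum_list_upt_bij[OF bij_rho, of "\<lambda>x. f [x]"]
    by (simp add: sum_vecs_Suc vecs_0 comp_def)
next
  case (Suc k)
  have "(\<Sum>u\<leftarrow>cols (Galpha g s e q (Suc (Suc k))). f u)
      = (\<Sum>j\<leftarrow>[0..<q ^ s]. \<Sum>u\<in>vecs UNIV (Suc k). f (rho g s e q j # u))"
    unfolding cols_Galpha_Suc
    by (simp add: sum_list_concat_map comp_def Suc.IH del: Galpha.simps)
  then show ?case using sum_list_upt_bij[OF bij_rho, of "\<lambda>x. \<Sum>u\<in>vecs UNIV (Suc k). f (x # u)"]
    by (simp only: sum_vecs_Suc[of f])
qed

lemma sum_vecs_unit_scale:
  assumes "t dvd (1 :: 'a)"
  shows "(\<Sum>u\<in>vecs UNIV k. f (map ((*) t) u)) = sum f (vecs UNIV k)"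
proof -
  obtain t' where t': "t * t' = 1" using assms by (auto elim: dvdE)
  then have t'': "t' * t = 1" by (simp add: mult.commute)
  show ?thesis
    by (rule sum.reindex_bij_witness[of _ "map ((*) t')" "map ((*) t)"])
      (auto simp: vecs_def comp_def t' t'' simp flip: mult.assoc)
qed

lemma sum_ideal_unit_scale:
  assumes "t dvd (1 :: 'a)"
  shows "(\<Sum>a\<in>{x. g dvd x}. f (t * a)) = (\<Sum>a\<in>{x. g dvd x}. f a)"
proof -
  obtain t' where t': "t * t' = 1" using assms by (auto elim: dvdE)
  then have t'': "t' * t = 1" by (simp add: mult.commute)
  show ?thesis
    by (rule sum.reindex_bij_witness[of _ "(*) t'" "(*) t"])
      (auto simp: t' t'' simp flip: mult.assoc)
qed

text \<open>The columns of the beta matrix are representatives, up to units, of the vectors having a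
  unit entry; the second summand on the left accounts for the vectors without one.\<close>
lemma sum_cols_Gbeta:
  fixes f :: "'a list \<Rightarrow> nat"
  shows "(\<Sum>t\<in>{t. t dvd 1}. \<Sum>u\<leftarrow>cols (Gbeta g s e q (Suc k)). f (map ((*) t) u))
     + sum f (vecs {x. g dvd x} (Suc k)) = sum f (vecs UNIV (Suc k))"
proof (induction k arbitrary: f)
  let ?U = "{t :: 'a. t dvd 1}" and ?I = "{x. g dvd x}"
  have split: "sum h ?U + sum h ?I = sum h UNIV" for h :: "'a \<Rightarrow> nat"
  proof -
    have "?U = UNIV - ?I" by (auto simp: unit_iff p_zero_iff)
    then show ?thesis by (simp add: sum.subset_diff[of ?I UNIV h])
  qed
  {
    case 0
    have "cols (Gbeta g s e q (Suc 0)) = [[1]]" by (simp add: cols_def)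
    then show ?case using split[of "\<lambda>x. f [x]"] by (simp add: sum_vecs_Suc vecs_0)
  next
    case (Suc k)
    let ?B = "cols (Gbeta g s e q (Suc k))"
    have swap: "(\<Sum>t\<in>?U. \<Sum>a\<in>?I. \<Sum>u\<leftarrow>?B. f (t * a # map ((*) t) u))
        = (\<Sum>a\<in>?I. \<Sum>t\<in>?U. \<Sum>u\<leftarrow>?B. f (a # map ((*) t) u))"
      (is "?l = _")
    proof -
      have "?l = (\<Sum>t\<in>?U. \<Sum>a\<in>?I. \<Sum>u\<leftarrow>?B. f (a # map ((*) t) u))"
        by (rule sum.cong[OF refl], rule sum_ideal_unit_scale) simp
      then show ?thesis by (subst (asm) sum.swap)
    qed
    \<comment> \<open>The leading 1 of the alpha block becomes \<open>t\<close>, while the part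
      below runs over all vectors and is only permuted by \<open>t\<close>.\<close>
    have inner: "(\<Sum>u\<leftarrow>cols (Gbeta g s e q (Suc (Suc k))). f (map ((*) t) u))
        = (\<Sum>u\<in>vecs UNIV (Suc k). f (t # u)) + (\<Sum>a\<in>?I. \<Sum>u\<leftarrow>?B. f (t * a # map ((*) t) u))"
      if "t dvd 1" for t
    proof -
      have "(\<Sum>u\<leftarrow>cols (Gbeta g s e q (Suc (Suc k))). f (map ((*) t) u))
        = (\<Sum>u\<leftarrow>cols (Galpha g s e q (Suc k)). f (t # map ((*) t) u))
          + (\<Sum>j\<leftarrow>[0..<q ^ (s - 1)]. \<Sum>u\<leftarrow>?B. f (t * aelt g s e q j # map ((*) t) u))"
        unfolding cols_Gbeta_Suc
        by (simp add: sum_list_concat_map comp_def del: Galpha.simps Gbeta.simps)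
      also have "(\<Sum>u\<leftarrow>cols (Galpha g s e q (Suc k)). f (t # map ((*) t) u))
          = (\<Sum>u\<in>vecs UNIV (Suc k). f (t # u))"
        unfolding sum_cols_Galpha by (rule sum_vecs_unit_scale[OF that])
      finally show ?thesis
        using sum_list_upt_bij[OF bij_aelt, of "\<lambda>a. \<Sum>u\<leftarrow>?B. f (t * a # map ((*) t) u)"]
        by simp
    qed
    have units: "(\<Sum>t\<in>?U. \<Sum>u\<leftarrow>cols (Gbeta g s e q (Suc (Suc k))). f (map ((*) t) u))
        = (\<Sum>t\<in>?U. \<Sum>u\<in>vecs UNIV (Suc k). f (t # u))
          + (\<Sum>a\<in>?I. \<Sum>t\<in>?U. \<Sum>u\<leftarrow>?B. f (a # map ((*) t) u))"
      using swap by (simp add: inner sum.distrib del: Gbeta.simps)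
    have "(\<Sum>t\<in>?U. \<Sum>u\<leftarrow>cols (Gbeta g s e q (Suc (Suc k))). f (map ((*) t) u))
          + sum f (vecs ?I (Suc (Suc k)))
        = (\<Sum>t\<in>?U. \<Sum>u\<in>vecs UNIV (Suc k). f (t # u))
          + (\<Sum>a\<in>?I. (\<Sum>t\<in>?U. \<Sum>u\<leftarrow>?B. f (a # map ((*) t) u)) + (\<Sum>u\<in>vecs ?I (Suc k). f (a # u)))"
      unfolding units by (simp only: sum_vecs_Suc[of f] sum.distrib add.assoc)
    also have "\<dots> = (\<Sum>t\<in>?U. \<Sum>u\<in>vecs UNIV (Suc k). f (t # u))
          + (\<Sum>a\<in>?I. \<Sum>u\<in>vecs UNIV (Suc k). f (a # u))"
      by (intro arg_cong2[of _ _ _ _ "(+)"] refl sum.cong Suc.IH)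
    also have "\<dots> = sum f (vecs UNIV (Suc (Suc k)))"
      unfolding sum_vecs_Suc[of f] by (rule split)
    finally show ?case .
  }
qed

section \<open>Weights of the simplex code\<close>

text \<open>By the isometry this is the Hamming distance between the Gray images of two codewords
  whose coefficient vectors differ by \<open>c\<close>.\<close>

definition codew :: "nat \<Rightarrow> (nat \<Rightarrow> 'a) \<Rightarrow> nat" where
  "codew k c = (\<Sum>u\<leftarrow>cols (Gbeta g s e q k). homw (dot c u))"

lemma card_units': "card {t :: 'a. t dvd 1} = q * ((q - 1) * q ^ (s - 2))"
  unfolding card_units q_powers by (simp add: algebra_simps diff_mult_distrib2)

lemma is_ideal_maximal: "is_ideal {x. g dvd x}" and is_ideal_UNIV: "is_ideal (UNIV :: 'a set)"
  by (auto simp: is_ideal_def)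

text \<open>\<open>sum_cols_Gbeta\<close> is applied to the weight of \<open>dot c u\<close>, which
  unit factors do not change. The conditional term comes from the vectors over the maximal ideal, on
  which \<open>dot c\<close> vanishes if \<open>g\<close> annihilates the first \<open>k\<close>
  coefficients. The additive form avoids truncated subtraction.\<close>

lemma codew_eq:
  assumes k: "0 < k" and c: "\<exists>i<k. c i \<noteq> 0"
  shows "q * codew k c + (if \<exists>i<k. g * c i \<noteq> 0 then q ^ ((s - 1) * k) else 0) = q ^ (s * k)"
proof -
  let ?W = "(q - 1) * q ^ (s - 2)" and ?I = "{x. g dvd x}"
  obtain k' where k': "k = Suc k'" using k gr0_implies_Suc by blast
  have "(\<Sum>t\<in>{t. t dvd 1}. \<Sum>u\<leftarrow>cols (Gbeta g s e q k). homw (dot c (map ((*) t) u)))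
      = (q * ?W) * codew k c"
    by (simp add: dot_scale homw_unit codew_def card_units')
  moreover have "(\<Sum>u\<in>vecs UNIV k. homw (dot c u)) = q ^ (s * k) * ?W"
  proof -
    have "\<exists>i<k. \<exists>a\<in>UNIV. c i * a \<noteq> 0" using c by (metis UNIV_I mult.right_neutral)
    from sum_homw_dot[OF is_ideal_UNIV this, of 0] show ?thesis
      by (simp add: card_ring power_mult)
  qed
  moreover have "(\<Sum>u\<in>vecs ?I k. homw (dot c u))
      = (if \<exists>i<k. g * c i \<noteq> 0 then q ^ ((s - 1) * k) else 0) * ?W"
  proof (cases "\<exists>i<k. g * c i \<noteq> 0")
    case True
    then have "\<exists>i<k. \<exists>a\<in>?I. c i * a \<noteq> 0" by (metis dvd_refl mem_Collect_eq mult.commute)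
    from sum_homw_dot[OF is_ideal_maximal this, of 0] True show ?thesis
      by (simp add: card_maximal_ideal power_mult)
  next
    case False
    have "dot c u = 0" if "u \<in> vecs ?I k" for u
      unfolding dot_def
    proof (intro sum.neutral ballI)
      fix i assume i: "i \<in> {..<length u}"
      then have "u ! i \<in> set u" "i < k" using that by (auto simp: vecs_def)
      then have "g dvd u ! i" "g * c i = 0" using that False unfolding vecs_def by blast+
      then obtain r where "u ! i = g * r" by (auto elim: dvdE)
      then have "c i * u ! i = (g * c i) * r" by (simp add: mult_ac)
      then show "c i * u ! i = 0" using \<open>g * c i = 0\<close> by simp
    qed
    then have "(\<Sum>u\<in>vecs ?I k. homw (dot c u)) = 0" by (simp add: homw_def)
    then show ?thesis unfolding if_not_P[OF False] by simp
  qed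
  ultimately have "(q * ?W) * codew k c
      + (if \<exists>i<k. g * c i \<noteq> 0 then q ^ ((s - 1) * k) else 0) * ?W = q ^ (s * k) * ?W"
    using sum_cols_Gbeta[where f = "\<lambda>u. homw (dot c u)" and k = k'] unfolding k' by simp
  then have "?W * (q * codew k c + (if \<exists>i<k. g * c i \<noteq> 0 then q ^ ((s - 1) * k) else 0))
      = ?W * q ^ (s * k)"
    by (simp only: distrib_left mult_ac)
  moreover have "?W \<noteq> 0" using q_ge_2 by simp
  ultimately show ?thesis by (simp only: mult_cancel_left simp_thms)
qed

text \<open>With the constant function 1, \<open>sum_cols_Gbeta\<close> says that units times
  columns number the vectors with a unit entry. The factor \<open>q ^ (s - 1)\<close> is the length
  of the Gray image of one ring element.\<close>

lemma length_cols_Gbeta: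
  assumes "0 < k"
  shows "q ^ (s - 1) * length (cols (Gbeta g s e q k)) = q ^ ((s - 1) * k) * ((q ^ k - 1) div (q - 1))"
proof -
  obtain k' where k': "k = Suc k'" using assms gr0_implies_Suc by blast
  obtain r where r: "s = Suc r" using s2 by (cases s) auto
  let ?n = "length (cols (Gbeta g s e q k))"
  have "(q ^ s - q ^ (s - 1)) * ?n + (q ^ (s - 1)) ^ k = (q ^ s) ^ k"
    using sum_cols_Gbeta[where f = "\<lambda>_. 1" and k = k'] unfolding k'
    by (simp add: card_vecs card_units card_maximal_ideal card_ring sum_list_triv del: Gbeta.simps power_Suc)
  moreover have "(q ^ s) ^ k = q ^ ((s - 1) * k) * q ^ k" "(q ^ (s - 1)) ^ k = q ^ ((s - 1) * k)"
    by (simp_all add: r power_mult power_mult_distrib)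
  moreover have "q ^ s - q ^ (s - 1) = q ^ (s - 1) * (q - 1)"
    by (simp add: r diff_mult_distrib2 mult.commute)
  ultimately have "q ^ (s - 1) * (q - 1) * ?n + q ^ ((s - 1) * k) = q ^ ((s - 1) * k) * q ^ k"
    by simp
  then have "q ^ (s - 1) * ?n * (q - 1) = q ^ ((s - 1) * k) * q ^ k - q ^ ((s - 1) * k)"
    by (simp add: mult_ac)
  also have "\<dots> = q ^ ((s - 1) * k) * (q ^ k - 1)" by (simp add: diff_mult_distrib2)
  also have "q ^ k - 1 = (q ^ k - 1) div (q - 1) * (q - 1)"
  proof -
    have "int q - 1 dvd int q ^ k - 1" by (simp add: power_diff_1_eq)
    then have "int (q - 1) dvd int (q ^ k - 1)" using q_ge_2 by (simp add: of_nat_diff)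
    then have "q - 1 dvd q ^ k - 1" by (simp only: int_dvd_int_iff)
    then show ?thesis by simp
  qed
  finally show ?thesis using q_ge_2 by simp
qed

lemma codew_values:
  assumes k: "0 < k"
  shows "codew k c = (if \<forall>i<k. c i = 0 then 0
     else if \<forall>i<k. g * c i = 0 then q ^ (s * k - 1) else q ^ (s * k - k - 1) * (q ^ k - 1))"
proof -
  consider "\<forall>i<k. c i = 0" | "\<exists>i<k. c i \<noteq> 0" "\<forall>i<k. g * c i = 0" | "\<exists>i<k. g * c i \<noteq> 0"
    by blast
  then show ?thesis
  proof cases
    case 1
    obtain k' where k': "k = Suc k'" using k gr0_implies_Suc by blast
    have "dot c u = 0" if "u \<in> set (cols (Gbeta g s e q k))" for u
    proof -
      have "length u = k" using cols_length[OF that] rect_Gbeta[of k'] k' by (simp add: rect_def)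
      then show ?thesis using 1 by (simp add: dot_def)
    qed
    then have "codew k c = (\<Sum>u\<leftarrow>cols (Gbeta g s e q k). 0)"
      unfolding codew_def by (intro arg_cong[of _ _ sum_list] map_cong) (auto simp: homw_def)
    then show ?thesis using 1 by simp
  next
    case 2
    have n: "\<not> (\<exists>i<k. g * c i \<noteq> 0)" using 2(2) by blast
    have "q * codew k c = q ^ (s * k)" using codew_eq[OF k 2(1)] unfolding if_not_P[OF n] by simp
    also have "\<dots> = q * q ^ (s * k - 1)"
      using k s2 by (simp flip: power_Suc)
    finally have "codew k c = q ^ (s * k - 1)"
      using q_ge_2 by (simp only: mult_cancel_left) linarith
    moreover have "\<not> (\<forall>i<k. c i = 0)" using 2(1) by blast
    ultimately show ?thesis using 2(2) by (simp only: if_False if_True) simp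
  next
    case 3
    then have c: "\<exists>i<k. c i \<noteq> 0" by (metis mult_zero_right)
    obtain r where r: "s = Suc (Suc r)" using s2 by (metis add_2_eq_Suc le_Suc_ex)
    \<comment> \<open>No subtraction is truncated here: \<open>2 \<le> s\<close> and
      \<open>0 < k\<close> make \<open>(s - 1) * k\<close> positive.\<close>
    have e: "(s - 1) * k = Suc (s * k - k - 1)" "s * k = (s - 1) * k + k"
      using k by (auto simp: r)
    have "q * codew k c + q ^ ((s - 1) * k) = q ^ (s * k)"
      using codew_eq[OF k c] 3 by simp
    then have "q * codew k c = q ^ ((s - 1) * k) * (q ^ k - 1)"
      unfolding e(2) power_add by (simp add: diff_mult_distrib2)
    also have "\<dots> = q * (q ^ (s * k - k - 1) * (q ^ k - 1))"
      unfolding e(1) by simp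
    finally have "codew k c = q ^ (s * k - k - 1) * (q ^ k - 1)"
      using q_ge_2 by (simp only: mult_cancel_left) linarith
    moreover have "\<not> (\<forall>i<k. c i = 0)" "\<not> (\<forall>i<k. g * c i = 0)" using c 3 by blast+
    ultimately show ?thesis by (simp only: if_False)
  qed
qed

text \<open>The columns have length \<open>k\<close>, so only the first \<open>k\<close>
  coefficients matter. This replaces coefficient functions by a finite set of lists that can be
  counted.\<close>

lemma row_module_Gbeta:
  assumes "0 < k"
  shows "row_module (Gbeta g s e q k) = (\<lambda>c. map (dot ((!) c)) (cols (Gbeta g s e q k))) ` vecs UNIV k"
proof -
  obtain k' where k': "k = Suc k'" using assms gr0_implies_Suc by blast
  have len: "length u = k" if "u \<in> set (cols (Gbeta g s e q k))" for u
    using cols_length[OF that] rect_Gbeta[of k'] k' by (simp add: rect_def)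
  show ?thesis unfolding row_module_cols
  proof (intro equalityI image_subsetI)
    fix c :: "nat \<Rightarrow> 'a"
    have "map (dot c) (cols (Gbeta g s e q k)) = map (dot ((!) (map c [0..<k]))) (cols (Gbeta g s e q k))"
      by (rule map_cong) (auto simp: dot_def len)
    moreover have "map c [0..<k] \<in> vecs UNIV k" by (simp add: vecs_def)
    ultimately show "map (dot c) (cols (Gbeta g s e q k))
        \<in> (\<lambda>c. map (dot ((!) c)) (cols (Gbeta g s e q k))) ` vecs UNIV k"
      by (rule image_eqI)
  qed (rule rangeI)
qed

end

theorem theorem3p26:
  fixes g :: "'a::{comm_ring_1,finite}"
    and p :: "'a \<Rightarrow> 'f::{field,finite}"
    and e :: "nat \<Rightarrow> 'a"
    and s k q :: nat
    and vs :: "'f list list"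
  assumes q: "q = card (UNIV :: 'f set)"
    and chain: "is_chain_ring TYPE('a)"
    and hom: "is_ring_hom p" and surj: "surj p"
    and ker: "{x. p x = 0} = pideal g"
    and nil: "g ^ s = 0" and least: "\<forall>t<s. g ^ t \<noteq> 0"
    and s2: "2 \<le> s"
    and e0: "e 0 = 0" and e1: "e 1 = 1"
    and reps: "bij_betw (p \<circ> e) {0..<q} UNIV"
    and vs: "distinct vs" "set vs = {v. length v = s - 1}"
    and k: "2 \<le> k"
  shows "(\<forall>c \<in> gray_vec p g s e q vs ` row_module (Gbeta g s e q k).
            length c = q ^ ((s - 1) * k) * ((q ^ k - 1) div (q - 1)))
       \<and> card (gray_vec p g s e q vs ` row_module (Gbeta g s e q k)) = q ^ (s * k)
       \<and> min_dist (gray_vec p g s e q vs ` row_module (Gbeta g s e q k))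
           = q ^ (s * k - k - 1) * (q ^ k - 1)
       \<and> (\<forall>l. wt_count (gray_vec p g s e q vs ` row_module (Gbeta g s e q k)) l =
              (if l = 0 then 1
               else if l = q ^ (s * k - 1) then q ^ k - 1
               else if l = q ^ (s * k - k - 1) * (q ^ k - 1) then q ^ (s * k) - q ^ k
               else 0))"
proof -
  interpret finite_chain_ring g p e s q
    using q hom surj ker nil least s2 e0 reps by unfold_locales
  let ?L = "vecs (UNIV :: 'a set) k" and ?G = "cols (Gbeta g s e q k)"
  let ?gr = "gray p g s e q vs"
  define lo where "lo = q ^ (s * k - k - 1) * (q ^ k - 1)"
  define hi where "hi = q ^ (s * k - 1)"
  define F where "F c = gray_vec p g s e q vs (map (dot ((!) c)) ?G)" for c
  have k0: "0 < k" using k by simp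
  have C: "gray_vec p g s e q vs ` row_module (Gbeta g s e q k) = F ` ?L"
    unfolding row_module_Gbeta[OF k0] image_image F_def ..
  have len_gray: "length (?gr x) = q ^ (s - 1)" for x
  proof -
    have "length vs = card (vecs (UNIV :: 'f set) (s - 1))"
      using vs by (simp add: vecs_def flip: distinct_card)
    then show ?thesis by (simp add: gray_def card_vecs q)
  qed
  have len: "length (F c) = q ^ ((s - 1) * k) * ((q ^ k - 1) div (q - 1))" for c
  proof -
    have "length (F c) = q ^ (s - 1) * length ?G"
      by (simp add: F_def gray_vec_def length_concat comp_def len_gray sum_list_triv)
    then show ?thesis using length_cols_Gbeta[OF k0] by simp
  qed
  \<comment> \<open>The Gray image need not be linear, so distances are computed for pairs; only the
    coefficient vectors are subtracted.\<close>
  have dist: "hdist (F c) (F d) = codew k (\<lambda>i. c ! i - d ! i)" for c d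
    unfolding F_def gray_vec_def codew_def dot_diff
    by (subst hdist_concat_map) (simp_all add: len_gray hdist_gray[OF vs])
  have "1 < q ^ k" using q_ge_2 k0 by (intro one_less_power) auto
  then have lo_pos: "0 < lo" unfolding lo_def using q_ge_2 by simp
  have lo_hi: "lo < hi"
  proof -
    have "2 * k \<le> s * k" using s2 by simp
    \<comment> \<open>The exponent \<open>s * k - k - 1\<close> is not truncated, so
      \<open>hi = q ^ (s * k - k - 1) * q ^ k\<close> exceeds \<open>lo\<close>.\<close>
    then have e: "s * k - 1 = (s * k - k - 1) + k" using k by linarith
    show ?thesis unfolding lo_def hi_def e power_add using q_ge_2 by simp
  qed
  have hi_pos: "0 < hi" using lo_hi by linarith
  have dist_values: "hdist (F c) (F d) = (if c = d then 0
      else if \<forall>i<k. g * (c ! i - d ! i) = 0 then hi else lo)" if "c \<in> ?L" "d \<in> ?L" for c d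
  proof -
    have "(\<forall>i<k. c ! i - d ! i = 0) \<longleftrightarrow> c = d" using that by (auto simp: vecs_def list_eq_iff_nth_eq)
    then show ?thesis unfolding dist codew_values[OF k0] lo_def hi_def by simp
  qed
  \<comment> \<open>Distinct coefficient vectors have images at the positive distance
    \<open>lo\<close> or \<open>hi\<close>, so codewords can be counted by their
    coefficients.\<close>
  have inj: "inj_on F ?L"
  proof (rule inj_onI, rule ccontr)
    fix c d assume *: "c \<in> ?L" "d \<in> ?L" "F c = F d" "c \<noteq> d"
    have "hdist (F c) (F d) = 0" by (simp add: \<open>F c = F d\<close> hdist_self_iff)
    then show False using dist_values[OF *(1,2)] * lo_pos hi_pos by (auto split: if_splits)
  qed
  have card_C: "card (F ` ?L) = q ^ (s * k)"
    by (simp add: card_image[OF inj] card_vecs card_ring power_mult)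
  \<comment> \<open>The digits of zero are zero and \<open>e 0 = 0\<close>, so \<open>z\<close>
    yields the zero word, and weights are distances to it.\<close>
  define z where "z = replicate k (0 :: 'a)"
  have z: "z \<in> ?L" "\<And>i. i < k \<Longrightarrow> z ! i = 0" by (simp_all add: z_def vecs_def)
  have Fz: "F z = replicate (length (F z)) 0"
  proof -
    have "dot ((!) z) u = 0" if "u \<in> set ?G" for u
    proof -
      obtain k' where k': "k = Suc k'" using k0 gr0_implies_Suc by blast
      have "length u = k" using cols_length[OF that] rect_Gbeta[of k'] k' by (simp add: rect_def)
      then show ?thesis by (simp add: dot_def z_def)
    qed
    moreover have "?gr 0 = replicate (length vs) 0"
    proof -
      have "p 0 = 0" by (simp add: p_zero_iff)
      then show ?thesis by (simp add: gray_def digit_zero e0 map_replicate_const)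
    qed
    ultimately have "\<forall>y\<in>set (F z). y = 0"
      by (auto simp: F_def gray_vec_def)
    then show ?thesis by (simp add: replicate_length_same)
  qed
  have hw: "hweight (F c) = hdist (F c) (F z)" for c
  proof -
    have "F z ! i = 0" if "i < length (F c)" for i
      using that Fz by (metis len nth_replicate)
    then show ?thesis by (auto simp: hweight_def hdist_def intro!: arg_cong[of _ _ card])
  qed
  have hw_values: "hweight (F c) = (if c = z then 0
      else if c \<in> vecs {x. g * x = 0} k then hi else lo)" if "c \<in> ?L" for c
  proof -
    have "(\<forall>i<k. g * (c ! i - z ! i) = 0) \<longleftrightarrow> c \<in> vecs {x. g * x = 0} k"
      using that z(2) by (auto simp: vecs_def in_set_conv_nth subset_iff)
    then show ?thesis unfolding hw dist_values[OF that z(1)] by simp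
  qed
  \<comment> \<open>The coefficient vectors with all entries in the socle; apart from
    \<open>z\<close> they give the weight \<open>hi\<close>.\<close>
  let ?A = "vecs {x. g * x = 0} k"
  have A: "card ?A = q ^ k" "?A \<subseteq> ?L" "z \<in> ?A" "finite ?L" "finite ?A"
    by (simp_all add: card_vecs card_annihilator finite_vecs) (auto simp: vecs_def z_def)
  have cnt: "wt_count (F ` ?L) l = card {c \<in> ?L. hweight (F c) = l}" for l
  proof -
    have "{x \<in> F ` ?L. hweight x = l} = F ` {c \<in> ?L. hweight (F c) = l}" by auto
    moreover have "inj_on F {c \<in> ?L. hweight (F c) = l}" by (rule inj_on_subset[OF inj]) auto
    ultimately show ?thesis unfolding wt_count_def by (simp only: card_image)
  qed
  have counts: "wt_count (F ` ?L) l =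
      (if l = 0 then 1 else if l = hi then q ^ k - 1 else if l = lo then q ^ (s * k) - q ^ k else 0)" for l
  proof -
    have "{c \<in> ?L. hweight (F c) = l} = (if l = 0 then {z} else if l = hi then ?A - {z}
        else if l = lo then ?L - ?A else {})"
      using lo_hi lo_pos hi_pos z(1) A(2,3) by (auto simp: hw_values split: if_splits)
    moreover have "card (?L - ?A) = q ^ (s * k) - q ^ k"
      using A by (simp add: card_Diff_subset card_vecs card_ring power_mult)
    ultimately show ?thesis using A by (simp add: cnt card_Diff_singleton)
  qed
  have mind: "min_dist (F ` ?L) = lo"
    unfolding min_dist_def
  proof (rule Min_eqI)
    let ?D = "{hdist x y | x y. x \<in> F ` ?L \<and> y \<in> F ` ?L \<and> x \<noteq> y}"
    have D: "y \<in> {lo, hi}" if y: "y \<in> ?D" for y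
    proof -
      obtain c d where "c \<in> ?L" "d \<in> ?L" "F c \<noteq> F d" "y = hdist (F c) (F d)" using y by auto
      then show ?thesis using dist_values[of c d] by (auto split: if_splits)
    qed
    then show "finite ?D" by (intro finite_subset[of ?D "{lo, hi}"] subsetI) auto
    show "lo \<le> y" if "y \<in> ?D" for y using D[OF that] lo_hi by auto
    \<comment> \<open>The all-one vector attains \<open>lo\<close> against \<open>z\<close>, since
      \<open>g * 1\<close> is nonzero.\<close>
    define c where "c = replicate k (1 :: 'a)"
    have c: "c \<in> ?L" "c \<noteq> z" using k0 by (auto simp: c_def z_def vecs_def)
    have "g \<noteq> 0" using power_zero_iff[of 1] s2 by simp
    then have "\<not> (\<forall>i<k. g * (c ! i - z ! i) = 0)" using z(2) k0 by (auto simp: c_def)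
    then have "hdist (F c) (F z) = lo" using dist_values[OF c(1) z(1)] c(2) by (simp only: if_False)
    moreover have "F c \<noteq> F z" using inj c z(1) by (auto dest: inj_onD)
    ultimately show "lo \<in> ?D" using c(1) z(1) by blast
  qed
  show ?thesis
    unfolding C using len card_C mind counts unfolding lo_def hi_def
    by (intro conjI ballI allI) (auto simp only:)
qed

end
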